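(* Let $(X_1,\star_1)$ and $(X_2,\star_2)$ be subquandle separable quandles, and let $f\in \mathrm{Z}(\mathrm{Inn}(X_1))$ and $g\in \mathrm{Z}(\mathrm{Inn}(X_2))$ be elements of finite order. Let $X=X_1\sqcup X_2$ be the quandle with operation $$x\ast y=\begin{cases} x\star_1 y & \text{if } x,y\in X_1,\\ x\star_2 y & \text{if } x,y\in X_2,\\ f(x) & \text{if } x\in X_1 \text{ and } y\in X_2,\\ g(x) & \text{if } x\in X_2 \text{ and } y\in X_1.\end{cases}$$ Then $(X,\ast)$ is subquandle separable.
   Context: A quandle is a set $X$ with a binary operation $*$ such that: (1) $x*x=x$ for all $x$; (2) for all $x,y \in X$ there is a unique $z\in X$ with $x=z*y$ (written $z=x*^{-1}y$); (3) $(x*y)*z=(x*z)*(y*z)$ for all $x,y,z$. For $x\in X$ the map $S_x:X\to X$, $S_x(y)=y*x$, is an automorphism of $X$; $\mathrm{Inn}(X)$ is the subgroup of $\mathrm{Aut}(X)$ generated by all $S_x$, and $\mathrm{Z}(\mathrm{Inn}(X))$ is its center. It is known that the operation $\ast$ on $X_1 \sqcup X_2$ in the claim defines a quandle whenever $f$ and $g$ are automorphisms centralizing $\mathrm{Inn}(X_1)$ in $\mathrm{Aut}(X_1)$ and $\mathrm{Inn}(X_2)$ in $\mathrm{Aut}(X_2)$ respectively. A subquandle is a subset closed under $*$ and $*^{-1}$; it is finitely generated if it is the smallest subquandle containing some finite set. A subset $S$ of a quandle $X$ is separable in $X$ if for each $x\in X\setminus S$ there exist a finite quandle $F$ and a quandle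 homomorphism $\phi:X\to F$ with $\phi(x)\notin\phi(S)$. A quandle is subquandle separable if each of its finitely generated subquandles is separable. *)

theory Defs
  imports "HOL-Algebra.Algebra"
begin

record 'a quandle = "'a partial_object" +
  qop :: "['a, 'a] \<Rightarrow> 'a" (infixl "\<star>\<index>" 70)

locale quandle =
  fixes Q (structure)
  assumes closed: "\<lbrakk>x \<in> carrier Q; y \<in> carrier Q\<rbrakk> \<Longrightarrow> x \<star> y \<in> carrier Q"
    and idem: "x \<in> carrier Q \<Longrightarrow> x \<star> x = x"
    and right_div: "\<lbrakk>x \<in> carrier Q; y \<in> carrier Q\<rbrakk> \<Longrightarrow> \<exists>!z. z \<in> carrier Q \<and> x = z \<star> y"
    and distrib: "\<lbrakk>x \<in> carrier Q; y \<in> carrier Q; z \<in> carrier Q\<rbrakk>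
      \<Longrightarrow> (x \<star> y) \<star> z = (x \<star> z) \<star> (y \<star> z)"

definition qdiv :: "('a, 'm) quandle_scheme \<Rightarrow> 'a \<Rightarrow> 'a \<Rightarrow> 'a" where
  "qdiv Q x y = (THE z. z \<in> carrier Q \<and> x = z \<star>\<^bsub>Q\<^esub> y)"

definition quandle_hom ::
  "('a, 'm) quandle_scheme \<Rightarrow> ('b, 'n) quandle_scheme \<Rightarrow> ('a \<Rightarrow> 'b) set" where
  "quandle_hom Q R = {h \<in> carrier Q \<rightarrow> carrier R.
     \<forall>x \<in> carrier Q. \<forall>y \<in> carrier Q. h (x \<star>\<^bsub>Q\<^esub> y) = h x \<star>\<^bsub>R\<^esub> h y}"

text \<open>As in \<^theory>\<open>HOL-Algebra.Bij\<close>, automorphisms are functions that are extensional on the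
  carrier, so that equality of functions is equality of automorphisms.\<close>

definition Aut :: "('a, 'm) quandle_scheme \<Rightarrow> ('a \<Rightarrow> 'a) monoid" where
  "Aut Q = BijGroup (carrier Q) \<lparr>carrier := quandle_hom Q Q \<inter> Bij (carrier Q)\<rparr>"

definition inner_map :: "('a, 'm) quandle_scheme \<Rightarrow> 'a \<Rightarrow> 'a \<Rightarrow> 'a" where
  "inner_map Q x = (\<lambda>y \<in> carrier Q. y \<star>\<^bsub>Q\<^esub> x)"

definition Inn :: "('a, 'm) quandle_scheme \<Rightarrow> ('a \<Rightarrow> 'a) monoid" where
  "Inn Q = Aut Q \<lparr>carrier := generate (Aut Q) (inner_map Q ` carrier Q)\<rparr>"

definition group_center :: "('a, 'm) monoid_scheme \<Rightarrow> 'a set" where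
  "group_center G = {z \<in> carrier G. \<forall>x \<in> carrier G. z \<otimes>\<^bsub>G\<^esub> x = x \<otimes>\<^bsub>G\<^esub> z}"

definition finite_order :: "('a, 'm) monoid_scheme \<Rightarrow> 'a \<Rightarrow> bool" where
  "finite_order G x \<longleftrightarrow> (\<exists>n::nat. n > 0 \<and> x [^]\<^bsub>G\<^esub> n = \<one>\<^bsub>G\<^esub>)"

definition subquandle :: "'a set \<Rightarrow> ('a, 'm) quandle_scheme \<Rightarrow> bool" where
  "subquandle Y Q \<longleftrightarrow> Y \<subseteq> carrier Q \<and>
     (\<forall>x \<in> Y. \<forall>y \<in> Y. x \<star>\<^bsub>Q\<^esub> y \<in> Y \<and> qdiv Q x y \<in> Y)"

definition finitely_generated_subquandle :: "'a set \<Rightarrow> ('a, 'm) quandle_scheme \<Rightarrow> bool" where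
  "finitely_generated_subquandle Y Q \<longleftrightarrow> subquandle Y Q \<and>
     (\<exists>A. finite A \<and> A \<subseteq> Y \<and> (\<forall>Z. subquandle Z Q \<and> A \<subseteq> Z \<longrightarrow> Y \<subseteq> Z))"

text \<open>The finite quandle is taken with carrier a set of natural numbers, since a definition cannot
  quantify over types. The lemma \<open>separated_by_any_finite_quandle\<close> below shows that finite
  quandles over an arbitrary type separate nothing more.\<close>

definition separable_in :: "'a set \<Rightarrow> ('a, 'm) quandle_scheme \<Rightarrow> bool" where
  "separable_in S Q \<longleftrightarrow> S \<subseteq> carrier Q \<and>
     (\<forall>x \<in> carrier Q - S. \<exists>(F :: nat quandle) \<phi>.
        quandle F \<and> finite (carrier F) \<and> \<phi> \<in> quandle_hom Q F \<and> \<phi> x \<notin> \<phi> ` S)"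

lemma separated_by_any_finite_quandle:
  fixes F :: "('c, 'n) quandle_scheme"
  assumes F: "quandle F" and fin: "finite (carrier F)"
    and hom: "\<phi> \<in> quandle_hom Q F" and x: "x \<in> carrier Q" and S: "S \<subseteq> carrier Q"
    and sep: "\<phi> x \<notin> \<phi> ` S"
  shows "\<exists>(G :: nat quandle) \<psi>.
    quandle G \<and> finite (carrier G) \<and> \<psi> \<in> quandle_hom Q G \<and> \<psi> x \<notin> \<psi> ` S"
proof -
  interpret F: quandle F by (rule F)
  obtain e :: "'c \<Rightarrow> nat" where inj: "inj_on e (carrier F)"
    using finite_imp_inj_to_nat_seg[OF fin] by blast
  define d where "d = inv_into (carrier F) e"
  have d: "d (e a) = a" if "a \<in> carrier F" for a
    using that inj by (simp add: d_def)
  define G :: "nat quandle" where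
    "G = \<lparr>carrier = e ` carrier F, qop = \<lambda>m n. e (d m \<star>\<^bsub>F\<^esub> d n)\<rparr>"
  have op: "e a \<star>\<^bsub>G\<^esub> e b = e (a \<star>\<^bsub>F\<^esub> b)" if "a \<in> carrier F" "b \<in> carrier F" for a b
    using that by (simp add: G_def d)
  have car: "carrier G = e ` carrier F" by (simp add: G_def)
  have "quandle G"
  proof
    fix m n assume "m \<in> carrier G" "n \<in> carrier G"
    then obtain a b where ab: "a \<in> carrier F" "b \<in> carrier F" "m = e a" "n = e b"
      by (auto simp: car)
    then show "m \<star>\<^bsub>G\<^esub> n \<in> carrier G" by (simp add: op car F.closed)
    obtain c where c: "c \<in> carrier F" "a = c \<star>\<^bsub>F\<^esub> b"
      and uniq: "\<And>c'. c' \<in> carrier F \<Longrightarrow> a = c' \<star>\<^bsub>F\<^esub> b \<Longrightarrow> c' = c"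
      using F.right_div[OF ab(1,2)] by blast
    show "\<exists>!k. k \<in> carrier G \<and> m = k \<star>\<^bsub>G\<^esub> n"
    proof (rule ex1I[of _ "e c"])
      show "e c \<in> carrier G \<and> m = e c \<star>\<^bsub>G\<^esub> n" using c ab by (simp add: op car)
    next
      fix k assume k: "k \<in> carrier G \<and> m = k \<star>\<^bsub>G\<^esub> n"
      then obtain c' where c': "c' \<in> carrier F" "k = e c'" by (auto simp: car)
      with k ab have "e a = e (c' \<star>\<^bsub>F\<^esub> b)" by (simp add: op)
      then have "a = c' \<star>\<^bsub>F\<^esub> b" using ab c' F.closed inj by (meson inj_onD)
      then show "k = e c" using uniq c' by blast
    qed
  next
    fix l m n assume "l \<in> carrier G" "m \<in> carrier G" "n \<in> carrier G"
    then obtain a b c where "a \<in> carrier F" "b \<in> carrier F" "c \<in> carrier F"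
      "l = e a" "m = e b" "n = e c"
      by (auto simp: car)
    then show "(l \<star>\<^bsub>G\<^esub> m) \<star>\<^bsub>G\<^esub> n = (l \<star>\<^bsub>G\<^esub> n) \<star>\<^bsub>G\<^esub> (m \<star>\<^bsub>G\<^esub> n)"
      using F.distrib[of a b c] by (simp add: op F.closed)
  qed (auto simp: car op F.idem)
  moreover have "finite (carrier G)" using fin by (simp add: car)
  moreover have "e \<circ> \<phi> \<in> quandle_hom Q G"
    using hom by (auto simp: quandle_hom_def car op Pi_iff)
  moreover have "(e \<circ> \<phi>) x \<notin> (e \<circ> \<phi>) ` S"
  proof
    assume "(e \<circ> \<phi>) x \<in> (e \<circ> \<phi>) ` S"
    then obtain s where s: "s \<in> S" "e (\<phi> x) = e (\<phi> s)" by auto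
    moreover have "\<phi> x \<in> carrier F" "\<phi> s \<in> carrier F"
      using hom x s S by (auto simp: quandle_hom_def)
    ultimately have "\<phi> x = \<phi> s" using inj by (meson inj_onD)
    with s sep show False by blast
  qed
  ultimately show ?thesis by blast
qed

definition subquandle_separable :: "('a, 'm) quandle_scheme \<Rightarrow> bool" where
  "subquandle_separable Q \<longleftrightarrow> quandle Q \<and>
     (\<forall>Y. finitely_generated_subquandle Y Q \<longrightarrow> separable_in Y Q)"

definition quandle_union ::
  "('a, 'm) quandle_scheme \<Rightarrow> ('a \<Rightarrow> 'a) \<Rightarrow> ('b, 'n) quandle_scheme \<Rightarrow> ('b \<Rightarrow> 'b) \<Rightarrow> ('a + 'b) quandle"
where
  "quandle_union Q\<^sub>1 f Q\<^sub>2 g =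
     \<lparr>carrier = carrier Q\<^sub>1 <+> carrier Q\<^sub>2,
      qop = (\<lambda>u v. case (u, v) of
          (Inl x, Inl y) \<Rightarrow> Inl (x \<star>\<^bsub>Q\<^sub>1\<^esub> y)
        | (Inr x, Inr y) \<Rightarrow> Inr (x \<star>\<^bsub>Q\<^sub>2\<^esub> y)
        | (Inl x, Inr y) \<Rightarrow> Inl (f x)
        | (Inr x, Inl y) \<Rightarrow> Inr (g x))\<rparr>"

end

theory Submission
  imports Defs
begin

text \<open>
  A finitely generated subquandle $Y$ of the union is studied through its traces $Y_i$ on $X_i$, and
  a point of $X_i$ outside $Y$ is separated from $Y$ by separating it from $Y_i$ inside $X_i$. Two
  things have to be checked.

  The trace $Y_1$ must again be finitely generated (\<open>finitely_generated_Inl_part\<close>). If $Y$ misses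
  $X_2$, the old generators serve. Otherwise acting by a point of $Y \cap X_2$ applies $f$, so $Y_1$
  is generated by the $f$-orbits of the generators lying in $X_1$. These orbits are finite because
  $f$ has finite order.

  A homomorphism $\phi$ from $X_1$ to a finite quandle must extend to the union
  (\<open>separate_Inl\<close>). The map $f$ is a product of translations $S_x^{\pm 1}$, so it preserves the
  fibres of $\phi$ (\<open>inner_automorphism_respects_hom\<close>) and descends to a map $f'$ on the image
  $\phi(X_1)$. The descended map is a central automorphism of that finite quandle, so the union of
  $\phi(X_1)$, twisted by $f'$, with a single point is a finite quandle. Collapsing $X_2$ to the point
  extends $\phi$, and no element of $X_2$ is sent into $\phi(X_1)$, so nothing in $Y \cap X_2$
  interferes with the separation.

  Points of $X_2$ are handled by exchanging the two summands.
\<close>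

section \<open>Subquandles and homomorphisms\<close>

context quandle
begin

lemma right_cancel:
  assumes "x \<in> carrier Q" "y \<in> carrier Q" "z \<in> carrier Q" "x \<star> z = y \<star> z"
  shows "x = y"
proof -
  have "\<exists>!w. w \<in> carrier Q \<and> x \<star> z = w \<star> z"
    by (rule right_div[OF closed[OF assms(1,3)] assms(3)])
  then show ?thesis using assms by metis
qed

lemma qdiv_closed: "\<lbrakk>x \<in> carrier Q; y \<in> carrier Q\<rbrakk> \<Longrightarrow> qdiv Q x y \<in> carrier Q"
  and qdiv_mult: "\<lbrakk>x \<in> carrier Q; y \<in> carrier Q\<rbrakk> \<Longrightarrow> qdiv Q x y \<star> y = x"
  using theI'[OF right_div[of x y]] unfolding qdiv_def by auto

lemma qdiv_eqI:
  assumes "z \<in> carrier Q" "y \<in> carrier Q" "z \<star> y = x"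
  shows "qdiv Q x y = z"
proof -
  have x: "x \<in> carrier Q" using closed[OF assms(1,2)] assms(3) by simp
  show ?thesis
    using qdiv_mult[OF x assms(2)] assms(3)
    by (intro right_cancel[OF qdiv_closed[OF x assms(2)] assms(1,2)]) simp
qed

lemma subquandle_carrier: "subquandle (carrier Q) Q"
  by (simp add: subquandle_def closed qdiv_closed)

lemma quandle_restrict:
  assumes "subquandle Y Q"
  shows "quandle (Q\<lparr>carrier := Y\<rparr>)"
proof
  have Y: "Y \<subseteq> carrier Q" using assms by (simp add: subquandle_def)
  fix x y assume xy: "x \<in> carrier (Q\<lparr>carrier := Y\<rparr>)" "y \<in> carrier (Q\<lparr>carrier := Y\<rparr>)"
  then show "x \<star>\<^bsub>Q\<lparr>carrier := Y\<rparr>\<^esub> y \<in> carrier (Q\<lparr>carrier := Y\<rparr>)"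
    using assms by (simp add: subquandle_def)
  show "\<exists>!z. z \<in> carrier (Q\<lparr>carrier := Y\<rparr>) \<and> x = z \<star>\<^bsub>Q\<lparr>carrier := Y\<rparr>\<^esub> y"
  proof (rule ex1I[of _ "qdiv Q x y"])
    show "qdiv Q x y \<in> carrier (Q\<lparr>carrier := Y\<rparr>) \<and> x = qdiv Q x y \<star>\<^bsub>Q\<lparr>carrier := Y\<rparr>\<^esub> y"
      using xy Y assms qdiv_mult[of x y, symmetric] by (auto simp: subquandle_def)
  next
    fix z assume "z \<in> carrier (Q\<lparr>carrier := Y\<rparr>) \<and> x = z \<star>\<^bsub>Q\<lparr>carrier := Y\<rparr>\<^esub> y"
    then show "z = qdiv Q x y"
      using xy Y by (auto intro!: qdiv_eqI[symmetric])
  qed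
next
  have Y: "Y \<subseteq> carrier Q" using assms by (simp add: subquandle_def)
  fix x y z
  assume "x \<in> carrier (Q\<lparr>carrier := Y\<rparr>)" "y \<in> carrier (Q\<lparr>carrier := Y\<rparr>)"
    "z \<in> carrier (Q\<lparr>carrier := Y\<rparr>)"
  then show "(x \<star>\<^bsub>Q\<lparr>carrier := Y\<rparr>\<^esub> y) \<star>\<^bsub>Q\<lparr>carrier := Y\<rparr>\<^esub> z =
      (x \<star>\<^bsub>Q\<lparr>carrier := Y\<rparr>\<^esub> z) \<star>\<^bsub>Q\<lparr>carrier := Y\<rparr>\<^esub> (y \<star>\<^bsub>Q\<lparr>carrier := Y\<rparr>\<^esub> z)"
    using Y distrib[of x y z] by auto
next
  fix x assume "x \<in> carrier (Q\<lparr>carrier := Y\<rparr>)"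
  then show "x \<star>\<^bsub>Q\<lparr>carrier := Y\<rparr>\<^esub> x = x"
    using assms idem by (auto simp: subquandle_def)
qed

end

lemma quandle_hom_closed: "\<lbrakk>h \<in> quandle_hom Q R; x \<in> carrier Q\<rbrakk> \<Longrightarrow> h x \<in> carrier R"
  by (auto simp: quandle_hom_def)

lemma quandle_hom_mult:
  "\<lbrakk>h \<in> quandle_hom Q R; x \<in> carrier Q; y \<in> carrier Q\<rbrakk> \<Longrightarrow> h (x \<star>\<^bsub>Q\<^esub> y) = h x \<star>\<^bsub>R\<^esub> h y"
  by (auto simp: quandle_hom_def)

lemma quandle_hom_comp:
  "\<lbrakk>h \<in> quandle_hom Q R; k \<in> quandle_hom R S\<rbrakk> \<Longrightarrow> k \<circ> h \<in> quandle_hom Q S"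
  by (auto simp: quandle_hom_def Pi_iff)

lemma quandle_hom_qdiv:
  assumes "quandle Q" "quandle R" "h \<in> quandle_hom Q R" "x \<in> carrier Q" "y \<in> carrier Q"
  shows "h (qdiv Q x y) = qdiv R (h x) (h y)"
proof -
  interpret Q: quandle Q by fact
  interpret R: quandle R by fact
  have "h (qdiv Q x y) \<star>\<^bsub>R\<^esub> h y = h x"
    using assms(3-) by (metis Q.qdiv_closed Q.qdiv_mult quandle_hom_mult)
  then show ?thesis
    using assms(3-) by (metis Q.qdiv_closed R.qdiv_eqI quandle_hom_closed)
qed

lemma subquandle_image:
  assumes "quandle Q" "quandle R" "h \<in> quandle_hom Q R" "subquandle Y Q"
  shows "subquandle (h ` Y) R"
proof -
  have Y: "Y \<subseteq> carrier Q" using assms by (simp add: subquandle_def)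
  have "h x \<star>\<^bsub>R\<^esub> h y \<in> h ` Y \<and> qdiv R (h x) (h y) \<in> h ` Y" if "x \<in> Y" "y \<in> Y" for x y
  proof -
    have "x \<in> carrier Q" "y \<in> carrier Q" using that Y by auto
    then have "h x \<star>\<^bsub>R\<^esub> h y = h (x \<star>\<^bsub>Q\<^esub> y)" "qdiv R (h x) (h y) = h (qdiv Q x y)"
      using assms by (simp_all add: quandle_hom_mult quandle_hom_qdiv)
    then show ?thesis using that assms(4) by (simp add: subquandle_def)
  qed
  then show ?thesis using Y quandle_hom_closed[OF assms(3)] by (auto simp: subquandle_def)
qed

lemma subquandle_preimage:
  assumes "quandle Q" "quandle R" "h \<in> quandle_hom Q R" "subquandle Z R"
  shows "subquandle {x \<in> carrier Q. h x \<in> Z} Q"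
proof -
  interpret Q: quandle Q by fact
  show ?thesis using assms
    by (auto simp: subquandle_def Q.closed Q.qdiv_closed quandle_hom_mult quandle_hom_qdiv)
qed

lemma finitely_generated_subquandleE:
  assumes "finitely_generated_subquandle Y Q"
  obtains A where "subquandle Y Q" "finite A" "A \<subseteq> Y"
    "\<And>Z. subquandle Z Q \<Longrightarrow> A \<subseteq> Z \<Longrightarrow> Y \<subseteq> Z"
proof -
  obtain A where A: "finite A \<and> A \<subseteq> Y \<and> (\<forall>Z. subquandle Z Q \<and> A \<subseteq> Z \<longrightarrow> Y \<subseteq> Z)"
    using assms unfolding finitely_generated_subquandle_def by blast
  then show thesis
    using assms that[of A] by (simp add: finitely_generated_subquandle_def)
qed

lemma finitely_generated_subquandleI:
  assumes "subquandle Y Q" "finite A" "A \<subseteq> Y"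
    "\<And>Z. subquandle Z Q \<Longrightarrow> A \<subseteq> Z \<Longrightarrow> Y \<subseteq> Z"
  shows "finitely_generated_subquandle Y Q"
proof -
  have "\<forall>Z. subquandle Z Q \<and> A \<subseteq> Z \<longrightarrow> Y \<subseteq> Z"
    by (intro allI impI) (elim conjE, rule assms(4))
  with assms(1-3) show ?thesis
    unfolding finitely_generated_subquandle_def by blast
qed

text \<open>The images of the generators generate: the preimage of a subquandle containing them is a
  subquandle containing the generators.\<close>

lemma finitely_generated_subquandle_image:
  assumes "quandle Q" "quandle R" "h \<in> quandle_hom Q R" "finitely_generated_subquandle Y Q"
  shows "finitely_generated_subquandle (h ` Y) R"
proof -
  obtain A where Y: "subquandle Y Q" and A: "finite A" "A \<subseteq> Y"
    and min: "\<And>Z. subquandle Z Q \<Longrightarrow> A \<subseteq> Z \<Longrightarrow> Y \<subseteq> Z"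
    using finitely_generated_subquandleE[OF assms(4)] by metis
  have "A \<subseteq> carrier Q" using A Y by (auto simp: subquandle_def)
  then have min': "h ` Y \<subseteq> Z" if "subquandle Z R" "h ` A \<subseteq> Z" for Z
    using min[OF subquandle_preimage[OF assms(1-3) that(1)]] that(2) by auto
  show ?thesis
    using A min'
    by (intro finitely_generated_subquandleI[OF subquandle_image[OF assms(1-3) Y], of "h ` A"])
      (simp_all add: image_mono)
qed

section \<open>Central automorphisms\<close>

text \<open>An automorphism $f$ commutes with the translation $S_y$ exactly when $f(x * y) = f(x) * y$ for
  all $x$. The last clause therefore says that $f$ centralizes the inner automorphism group. No
  extensionality is imposed, since only the values on the carrier enter the union.\<close>

definition central_automorphism :: "('a, 'm) quandle_scheme \<Rightarrow> ('a \<Rightarrow> 'a) \<Rightarrow> bool" where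
  "central_automorphism Q f \<longleftrightarrow> f \<in> quandle_hom Q Q \<and> bij_betw f (carrier Q) (carrier Q) \<and>
     (\<forall>x \<in> carrier Q. \<forall>y \<in> carrier Q. f (x \<star>\<^bsub>Q\<^esub> y) = f x \<star>\<^bsub>Q\<^esub> y)"

context quandle
begin

lemma subgroup_automorphisms: "subgroup (quandle_hom Q Q \<inter> Bij (carrier Q)) (BijGroup (carrier Q))"
proof (rule group.subgroupI[OF group_BijGroup])
  have "(\<lambda>x \<in> carrier Q. x) \<in> quandle_hom Q Q \<inter> Bij (carrier Q)"
    by (auto simp: quandle_hom_def closed id_Bij)
  then show "quandle_hom Q Q \<inter> Bij (carrier Q) \<noteq> {}" by blast
  show "quandle_hom Q Q \<inter> Bij (carrier Q) \<subseteq> carrier (BijGroup (carrier Q))"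
    by (simp add: BijGroup_def)
next
  fix h assume h: "h \<in> quandle_hom Q Q \<inter> Bij (carrier Q)"
  have bij: "bij_betw h (carrier Q) (carrier Q)" using h by (simp add: Bij_def)
  let ?k = "inv_into (carrier Q) h"
  have k: "?k x \<in> carrier Q" "h (?k x) = x" if "x \<in> carrier Q" for x
    using that bij bij_betw_inv_into_right bij_betw_imp_surj_on inv_into_into by metis+
  have "?k (x \<star> y) = ?k x \<star> ?k y" if "x \<in> carrier Q" "y \<in> carrier Q" for x y
  proof -
    have "h (?k x \<star> ?k y) = x \<star> y"
      using h k that quandle_hom_mult[of h Q Q "?k x" "?k y"] by simp
    then show ?thesis
      using bij k that closed by (metis bij_betw_inv_into_left)
  qed
  then have "restrict ?k (carrier Q) \<in> quandle_hom Q Q"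
    using k by (auto simp: quandle_hom_def closed)
  then show "inv\<^bsub>BijGroup (carrier Q)\<^esub> h \<in> quandle_hom Q Q \<inter> Bij (carrier Q)"
    using h by (simp add: inv_BijGroup restrict_inv_into_Bij)
next
  fix h k assume hk: "h \<in> quandle_hom Q Q \<inter> Bij (carrier Q)" "k \<in> quandle_hom Q Q \<inter> Bij (carrier Q)"
  then have "compose (carrier Q) h k \<in> quandle_hom Q Q"
    by (auto simp: quandle_hom_def compose_def closed Pi_iff)
  then show "h \<otimes>\<^bsub>BijGroup (carrier Q)\<^esub> k \<in> quandle_hom Q Q \<inter> Bij (carrier Q)"
    using hk by (simp add: BijGroup_def compose_Bij)
qed

lemma group_Aut: "group (Aut Q)"
  unfolding Aut_def using group.subgroup_imp_group[OF group_BijGroup subgroup_automorphisms] .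

lemma Aut_mult_apply:
  "\<lbrakk>h \<in> carrier (Aut Q); k \<in> carrier (Aut Q); x \<in> carrier Q\<rbrakk> \<Longrightarrow> (h \<otimes>\<^bsub>Aut Q\<^esub> k) x = h (k x)"
  by (simp add: Aut_def BijGroup_def compose_def)

lemma Aut_one_apply: "x \<in> carrier Q \<Longrightarrow> \<one>\<^bsub>Aut Q\<^esub> x = x"
  by (simp add: Aut_def BijGroup_def)

lemma Aut_apply_closed: "\<lbrakk>h \<in> carrier (Aut Q); x \<in> carrier Q\<rbrakk> \<Longrightarrow> h x \<in> carrier Q"
  by (auto simp: Aut_def quandle_hom_def)

lemma inner_map_apply: "x \<in> carrier Q \<Longrightarrow> inner_map Q z x = x \<star> z"
  by (simp add: inner_map_def)

lemma inner_map_Aut: assumes "z \<in> carrier Q" shows "inner_map Q z \<in> carrier (Aut Q)"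
proof -
  have "bij_betw (inner_map Q z) (carrier Q) (carrier Q)"
    unfolding inner_map_def
    by (rule bij_betw_byWitness[where f' = "\<lambda>x. qdiv Q x z"])
      (use assms in \<open>auto simp: closed qdiv_closed qdiv_mult intro: qdiv_eqI\<close>)
  then show ?thesis
    using assms by (auto simp: Aut_def Bij_def quandle_hom_def inner_map_def closed intro: distrib)
qed

lemma Inn_subset_Aut: "carrier (Inn Q) \<subseteq> carrier (Aut Q)"
  using group.generate_in_carrier[OF group_Aut, of "inner_map Q ` carrier Q"] inner_map_Aut
  by (auto simp: Inn_def)

lemma central_automorphism_if_center:
  assumes "f \<in> group_center (Inn Q)"
  shows "central_automorphism Q f"
proof -
  have f: "f \<in> carrier (Inn Q)"
    and comm: "\<And>h. h \<in> carrier (Inn Q) \<Longrightarrow> f \<otimes>\<^bsub>Inn Q\<^esub> h = h \<otimes>\<^bsub>Inn Q\<^esub> f"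
    using assms by (auto simp: group_center_def)
  have fA: "f \<in> carrier (Aut Q)" using f Inn_subset_Aut by blast
  have "f (x \<star> y) = f x \<star> y" if xy: "x \<in> carrier Q" "y \<in> carrier Q" for x y
  proof -
    have "inner_map Q y \<in> carrier (Inn Q)"
      using xy by (auto simp: Inn_def intro: generate.incl)
    from comm[OF this] have "(f \<otimes>\<^bsub>Aut Q\<^esub> inner_map Q y) x = (inner_map Q y \<otimes>\<^bsub>Aut Q\<^esub> f) x"
      by (simp add: Inn_def)
    then show ?thesis
      using xy fA Aut_apply_closed[OF fA] by (simp add: Aut_mult_apply inner_map_Aut inner_map_apply closed)
  qed
  then show ?thesis
    using fA by (simp add: central_automorphism_def Aut_def Bij_def)
qed

text \<open>Group powers of an automorphism are extensional functions; this passes to plain iteration on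
  points, where the orbit arguments take place.\<close>

lemma finite_order_funpow:
  assumes f: "f \<in> carrier (Inn Q)" and "finite_order (Inn Q) f"
  obtains n where "n > 0" "\<And>x. x \<in> carrier Q \<Longrightarrow> (f ^^ n) x = x"
proof -
  interpret A: group "Aut Q" by (rule group_Aut)
  have fA: "f \<in> carrier (Aut Q)" using f Inn_subset_Aut by blast
  have pow: "f [^]\<^bsub>Inn Q\<^esub> k = f [^]\<^bsub>Aut Q\<^esub> k" for k :: nat
    by (simp add: Inn_def nat_pow_def)
  have app: "(f [^]\<^bsub>Aut Q\<^esub> k) x = (f ^^ k) x" if "x \<in> carrier Q" for k :: nat and x
    using that
  proof (induction k arbitrary: x)
    case 0
    then show ?case by (simp add: Aut_one_apply)
  next
    case (Suc k)
    then show ?case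
      using fA Aut_apply_closed[OF fA] by (simp add: Aut_mult_apply funpow_swap1)
  qed
  obtain n :: nat where n: "n > 0" "f [^]\<^bsub>Inn Q\<^esub> n = \<one>\<^bsub>Inn Q\<^esub>"
    using assms(2) by (auto simp: finite_order_def)
  have "(f ^^ n) x = x" if "x \<in> carrier Q" for x
    using app[OF that, of n] n(2)[unfolded pow] that by (simp add: Inn_def Aut_one_apply)
  with n(1) that show thesis by blast
qed

text \<open>Each translation $S_z$ is carried by $\phi$ to the translation by $\phi(z)$, which is injective
  on $F$. So $S_z$ and its inverse both preserve the fibres of $\phi$, and so does every product of
  such maps. An arbitrary automorphism of $Q$ need not do this.\<close>

lemma inner_automorphism_respects_hom:
  assumes F: "quandle F" and hom: "\<phi> \<in> quandle_hom Q F" and h: "h \<in> carrier (Inn Q)"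
    and "x \<in> carrier Q" "y \<in> carrier Q" "\<phi> x = \<phi> y"
  shows "\<phi> (h x) = \<phi> (h y)"
proof -
  interpret F: quandle F by (rule F)
  interpret A: group "Aut Q" by (rule group_Aut)
  have "h \<in> generate (Aut Q) (inner_map Q ` carrier Q)" using h by (simp add: Inn_def)
  then show ?thesis using assms(4-)
  proof (induction arbitrary: x y)
    case one
    then show ?case by (simp add: Aut_one_apply)
  next
    case (incl h)
    then show ?case using hom by (auto simp: inner_map_def quandle_hom_mult)
  next
    case (inv h)
    then obtain z where z: "z \<in> carrier Q" "h = inner_map Q z" by blast
    let ?k = "inv\<^bsub>Aut Q\<^esub> h"
    have hA: "h \<in> carrier (Aut Q)" using z inner_map_Aut by simp
    have kA: "?k \<in> carrier (Aut Q)" using hA by simp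
    have k: "?k w \<star> z = w" if w: "w \<in> carrier Q" for w
    proof -
      have "(h \<otimes>\<^bsub>Aut Q\<^esub> ?k) w = w" using hA w by (simp add: Aut_one_apply)
      then show ?thesis
        using w hA kA Aut_apply_closed[OF kA w] inner_map_apply[of "?k w" z, folded z(2)]
        by (simp only: Aut_mult_apply)
    qed
    have "\<phi> (?k x) \<star>\<^bsub>F\<^esub> \<phi> z = \<phi> (?k y) \<star>\<^bsub>F\<^esub> \<phi> z"
      using k inv z hom Aut_apply_closed[OF kA] by (metis quandle_hom_mult)
    then show ?case
      using inv z hom Aut_apply_closed[OF kA] by (metis F.right_cancel quandle_hom_closed)
  next
    case (eng h k)
    have A: "h \<in> carrier (Aut Q)" "k \<in> carrier (Aut Q)"
      using eng.hyps Inn_subset_Aut by (auto simp: Inn_def)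
    have "\<phi> (k x) = \<phi> (k y)"
      using eng.prems by (rule eng.IH(2))
    then have "\<phi> (h (k x)) = \<phi> (h (k y))"
      using eng.prems by (intro eng.IH(1) Aut_apply_closed[OF A(2)])
    then show ?case using eng.prems(1,2) by (simp only: Aut_mult_apply[OF A])
  qed
qed

end

section \<open>The union of two quandles\<close>

lemma carrier_quandle_union: "carrier (quandle_union P f Q g) = carrier P <+> carrier Q"
  by (simp add: quandle_union_def)

lemma quandle_union_mult:
  "Inl x \<star>\<^bsub>quandle_union P f Q g\<^esub> Inl x' = Inl (x \<star>\<^bsub>P\<^esub> x')"
  "Inr y \<star>\<^bsub>quandle_union P f Q g\<^esub> Inr y' = Inr (y \<star>\<^bsub>Q\<^esub> y')"
  "Inl x \<star>\<^bsub>quandle_union P f Q g\<^esub> Inr y = Inl (f x)"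
  "Inr y \<star>\<^bsub>quandle_union P f Q g\<^esub> Inl x = Inr (g y)"
  by (simp_all add: quandle_union_def)

text \<open>Self-distributivity on mixed triples comes down to three identities: $f(x * y) = f(x) * y$ when
  only the middle element lies in the other summand, $f(x * y) = f(x) * f(y)$ when only the last one
  does, and $f(f(x)) = f(f(x))$ when both do. Unique right division by an element of the other
  summand is bijectivity of $f$.\<close>

lemma quandle_quandle_union:
  assumes "quandle P" "quandle Q" "central_automorphism P f" "central_automorphism Q g"
  shows "quandle (quandle_union P f Q g)" (is "quandle ?U")
proof -
  interpret P: quandle P by fact
  interpret Q: quandle Q by fact
  have bf: "bij_betw f (carrier P) (carrier P)" and bg: "bij_betw g (carrier Q) (carrier Q)"
    using assms by (simp_all add: central_automorphism_def)
  have f: "f x \<in> carrier P" "\<exists>!z. z \<in> carrier P \<and> x = f z" if "x \<in> carrier P" for x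
    using bf that by (auto simp: bij_betw_def inj_on_def)
  have g: "g x \<in> carrier Q" "\<exists>!z. z \<in> carrier Q \<and> x = g z" if "x \<in> carrier Q" for x
    using bg that by (auto simp: bij_betw_def inj_on_def)
  have fm: "f (x \<star>\<^bsub>P\<^esub> y) = f x \<star>\<^bsub>P\<^esub> y" "f x \<star>\<^bsub>P\<^esub> f y = f x \<star>\<^bsub>P\<^esub> y"
    if "x \<in> carrier P" "y \<in> carrier P" for x y
  proof -
    show "f (x \<star>\<^bsub>P\<^esub> y) = f x \<star>\<^bsub>P\<^esub> y"
      using assms that by (simp add: central_automorphism_def)
    moreover have "f (x \<star>\<^bsub>P\<^esub> y) = f x \<star>\<^bsub>P\<^esub> f y"
      using assms that quandle_hom_mult[of f P P x y] by (simp add: central_automorphism_def)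
    ultimately show "f x \<star>\<^bsub>P\<^esub> f y = f x \<star>\<^bsub>P\<^esub> y" by simp
  qed
  have gm: "g (x \<star>\<^bsub>Q\<^esub> y) = g x \<star>\<^bsub>Q\<^esub> y" "g x \<star>\<^bsub>Q\<^esub> g y = g x \<star>\<^bsub>Q\<^esub> y"
    if "x \<in> carrier Q" "y \<in> carrier Q" for x y
  proof -
    show "g (x \<star>\<^bsub>Q\<^esub> y) = g x \<star>\<^bsub>Q\<^esub> y"
      using assms that by (simp add: central_automorphism_def)
    moreover have "g (x \<star>\<^bsub>Q\<^esub> y) = g x \<star>\<^bsub>Q\<^esub> g y"
      using assms that quandle_hom_mult[of g Q Q x y] by (simp add: central_automorphism_def)
    ultimately show "g x \<star>\<^bsub>Q\<^esub> g y = g x \<star>\<^bsub>Q\<^esub> y" by simp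
  qed
  have left: "\<exists>!w. w \<in> carrier P <+> carrier Q \<and> Inl x = w \<star>\<^bsub>?U\<^esub> v"
    if x: "x \<in> carrier P" and v: "v \<in> carrier P <+> carrier Q" for x v
  proof -
    obtain h where h: "\<And>z. Inl z \<star>\<^bsub>?U\<^esub> v = Inl (h z)" "\<exists>!z. z \<in> carrier P \<and> x = h z"
    proof (cases v)
      case (Inl y)
      then have "y \<in> carrier P" using v by auto
      then show thesis using that[of "\<lambda>z. z \<star>\<^bsub>P\<^esub> y"] P.right_div[OF x] Inl quandle_union_mult by metis
    next
      case (Inr y)
      then show thesis using that[of f] f(2)[OF x] by (simp add: quandle_union_mult)
    qed
    \<comment> \<open>Right multiplication by $v$ never leaves a summand, so solutions lie in the summand of $x$.\<close>
    have other: "Inr z \<star>\<^bsub>?U\<^esub> v \<noteq> Inl x" for z by (cases v) (simp_all add: quandle_union_mult)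
    obtain z where z: "z \<in> carrier P" "x = h z"
      and unique: "\<And>z'. z' \<in> carrier P \<Longrightarrow> x = h z' \<Longrightarrow> z' = z"
      using h(2) by (elim ex1E) blast
    show ?thesis
    proof (rule ex1I[of _ "Inl z"])
      fix w assume w: "w \<in> carrier P <+> carrier Q \<and> Inl x = w \<star>\<^bsub>?U\<^esub> v"
      then obtain z' where z': "w = Inl z'" using other by (cases w) metis+
      then show "w = Inl z" using w unique[of z'] by (auto simp: h(1))
    qed (use z in \<open>auto simp: h(1)\<close>)
  qed
  have right: "\<exists>!w. w \<in> carrier P <+> carrier Q \<and> Inr x = w \<star>\<^bsub>?U\<^esub> v"
    if x: "x \<in> carrier Q" and v: "v \<in> carrier P <+> carrier Q" for x v
  proof -
    obtain h where h: "\<And>z. Inr z \<star>\<^bsub>?U\<^esub> v = Inr (h z)" "\<exists>!z. z \<in> carrier Q \<and> x = h z"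
    proof (cases v)
      case (Inr y)
      then have "y \<in> carrier Q" using v by auto
      then show thesis using that[of "\<lambda>z. z \<star>\<^bsub>Q\<^esub> y"] Q.right_div[OF x] Inr quandle_union_mult by metis
    next
      case (Inl y)
      then show thesis using that[of g] g(2)[OF x] by (simp add: quandle_union_mult)
    qed
    have other: "Inl z \<star>\<^bsub>?U\<^esub> v \<noteq> Inr x" for z by (cases v) (simp_all add: quandle_union_mult)
    obtain z where z: "z \<in> carrier Q" "x = h z"
      and unique: "\<And>z'. z' \<in> carrier Q \<Longrightarrow> x = h z' \<Longrightarrow> z' = z"
      using h(2) by (elim ex1E) blast
    show ?thesis
    proof (rule ex1I[of _ "Inr z"])
      fix w assume w: "w \<in> carrier P <+> carrier Q \<and> Inr x = w \<star>\<^bsub>?U\<^esub> v"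
      then obtain z' where z': "w = Inr z'" using other by (cases w) metis+
      then show "w = Inr z" using w unique[of z'] by (auto simp: h(1))
    qed (use z in \<open>auto simp: h(1)\<close>)
  qed
  show ?thesis
  proof
    fix u v w
    assume "u \<in> carrier ?U" "v \<in> carrier ?U" "w \<in> carrier ?U"
    then show "(u \<star>\<^bsub>?U\<^esub> v) \<star>\<^bsub>?U\<^esub> w = (u \<star>\<^bsub>?U\<^esub> w) \<star>\<^bsub>?U\<^esub> (v \<star>\<^bsub>?U\<^esub> w)"
      by (auto simp: carrier_quandle_union quandle_union_mult fm gm intro: P.distrib Q.distrib)
  next
    fix u v assume "u \<in> carrier ?U" and v: "v \<in> carrier ?U"
    from this(1) show "\<exists>!z. z \<in> carrier ?U \<and> u = z \<star>\<^bsub>?U\<^esub> v"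
      unfolding carrier_quandle_union
    proof (rule PlusE)
      fix x assume "x \<in> carrier P" "u = Inl x"
      then show "\<exists>!z. z \<in> carrier P <+> carrier Q \<and> u = z \<star>\<^bsub>?U\<^esub> v"
        using left v by (simp only: carrier_quandle_union)
    next
      fix x assume "x \<in> carrier Q" "u = Inr x"
      then show "\<exists>!z. z \<in> carrier P <+> carrier Q \<and> u = z \<star>\<^bsub>?U\<^esub> v"
        using right v by (simp only: carrier_quandle_union)
    qed
  qed (auto simp: carrier_quandle_union quandle_union_mult P.closed Q.closed P.idem Q.idem f g)
qed

lemma qdiv_quandle_union_Inl:
  assumes P: "quandle P" and U: "quandle (quandle_union P f Q g)"
    and x: "x \<in> carrier P"
  shows "x' \<in> carrier P \<Longrightarrow> qdiv (quandle_union P f Q g) (Inl x) (Inl x') = Inl (qdiv P x x')"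
    and "\<lbrakk>z \<in> carrier P; f z = x; y \<in> carrier Q\<rbrakk>
      \<Longrightarrow> qdiv (quandle_union P f Q g) (Inl x) (Inr y) = Inl z"
proof -
  interpret P: quandle P by fact
  interpret U: quandle "quandle_union P f Q g" by fact
  show "x' \<in> carrier P \<Longrightarrow> qdiv (quandle_union P f Q g) (Inl x) (Inl x') = Inl (qdiv P x x')"
    using x by (intro U.qdiv_eqI)
      (auto simp: carrier_quandle_union quandle_union_mult P.qdiv_closed P.qdiv_mult)
  show "\<lbrakk>z \<in> carrier P; f z = x; y \<in> carrier Q\<rbrakk>
      \<Longrightarrow> qdiv (quandle_union P f Q g) (Inl x) (Inr y) = Inl z"
    by (intro U.qdiv_eqI) (auto simp: carrier_quandle_union quandle_union_mult)
qed

lemma Inl_hom: "Inl \<in> quandle_hom P (quandle_union P f Q g)"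
  by (auto simp: quandle_hom_def carrier_quandle_union quandle_union_mult)

lemma swap_hom:
  "case_sum Inr Inl \<in> quandle_hom (quandle_union P f Q g) (quandle_union Q g P f)"
  by (auto simp: quandle_hom_def carrier_quandle_union quandle_union_mult)

section \<open>Separation in the union\<close>

text \<open>If the trace of \<open>Y\<close> is to be generated inside \<open>P\<close>, the effect of the elements of \<open>Q\<close> in \<open>Y\<close>
  has to be put into the generators: such an element acts on \<open>P\<close> as \<open>f\<close>, so the generators of \<open>Y\<close>
  in \<open>P\<close> are replaced by their orbits under \<open>f\<close>, which have at most \<open>n\<close> elements each.\<close>

lemma finitely_generated_Inl_part:
  assumes P: "quandle P" and Q: "quandle Q"
    and f: "central_automorphism P f" and g: "central_automorphism Q g"
    and n: "n > 0" "\<And>x. x \<in> carrier P \<Longrightarrow> (f ^^ n) x = x"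
    and fg: "finitely_generated_subquandle Y (quandle_union P f Q g)"
  shows "finitely_generated_subquandle (Inl -` Y) P"
proof -
  let ?U = "quandle_union P f Q g"
  interpret P: quandle P by (rule P)
  interpret Q: quandle Q by (rule Q)
  have qU: "quandle ?U" using P Q f g by (rule quandle_quandle_union)
  interpret U: quandle ?U by (rule qU)
  obtain A where Y: "subquandle Y ?U" and A: "finite A" "A \<subseteq> Y"
    and min: "\<And>Z. subquandle Z ?U \<Longrightarrow> A \<subseteq> Z \<Longrightarrow> Y \<subseteq> Z"
    using finitely_generated_subquandleE[OF fg] by metis
  have YU: "Y \<subseteq> carrier P <+> carrier Q"
    using Y by (simp add: subquandle_def carrier_quandle_union)
  have fhom: "f \<in> quandle_hom P P" using f by (simp add: central_automorphism_def)
  have pow_hom: "f ^^ k \<in> quandle_hom P P" for k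
  proof (induction k)
    case 0
    then show ?case by (simp add: quandle_hom_def)
  next
    case (Suc k)
    then show ?case using quandle_hom_comp[OF Suc fhom] by (simp only: funpow.simps)
  qed
  have fc: "f x \<in> carrier P" if "x \<in> carrier P" for x
    using fhom that by (rule quandle_hom_closed)
  have pow_closed: "(f ^^ k) x \<in> carrier P" if "x \<in> carrier P" for x k
    using pow_hom that by (rule quandle_hom_closed)
  have root: "f ((f ^^ (n - 1)) x) = x" if "x \<in> carrier P" for x
    using n that by (metis Suc_diff_1 comp_apply funpow.simps(2))
  have sub: "subquandle (Inl -` Y) P"
  proof -
    have "{x \<in> carrier P. Inl x \<in> Y} = Inl -` Y" using YU by auto
    then show ?thesis using subquandle_preimage[OF P qU Inl_hom Y] by simp
  qed
  show ?thesis
  proof (cases "Inr -` A = {}")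
    case True
    have AI: "A \<subseteq> range Inl"
    proof
      fix u assume "u \<in> A"
      with True show "u \<in> range Inl" by (cases u) auto
    qed
    have "Inl -` Y \<subseteq> Z" if Z: "subquandle Z P" "Inl -` A \<subseteq> Z" for Z
    proof -
      have "A \<subseteq> Inl ` Z" using AI Z(2) by blast
      then have "Y \<subseteq> Inl ` Z" by (rule min[OF subquandle_image[OF P qU Inl_hom Z(1)]])
      then show ?thesis by auto
    qed
    moreover have "finite (Inl -` A)" using A(1) by (simp add: finite_vimageI)
    ultimately show ?thesis
      using A(2)
      by (intro finitely_generated_subquandleI[OF sub, of "Inl -` A"]) (simp_all add: vimage_mono)
  next
    case False
    then obtain b where b: "Inr b \<in> Y" using A(2) by blast
    let ?B = "\<Union>k<n. (f ^^ k) ` (Inl -` A)"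
    have stable: "Inl ((f ^^ k) x) \<in> Y" if "Inl x \<in> Y" for x k
    proof (induction k)
      case (Suc k)
      then have "Inl ((f ^^ k) x) \<star>\<^bsub>?U\<^esub> Inr b \<in> Y" using Y b by (simp add: subquandle_def)
      then show ?case by (simp add: quandle_union_mult)
    qed (simp add: that)
    have "finite ?B" using A(1) by (simp add: finite_vimageI)
    moreover have "?B \<subseteq> Inl -` Y" using stable A(2) by auto
    moreover have "Inl -` Y \<subseteq> Z" if Z: "subquandle Z P" "?B \<subseteq> Z" for Z
    proof -
      \<comment> \<open>\<open>Z\<close> itself need not be stable under \<open>f\<close>. The elements whose whole orbit lies in \<open>Z\<close> form an
        \<open>f\<close>-stable subquandle of \<open>P\<close>, and only such a set becomes a subquandle of the union
        when \<open>Q\<close> is added to it.\<close>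
      let ?C = "{x \<in> carrier P. \<forall>k. (f ^^ k) x \<in> Z}"
      have fC: "(f ^^ k) x \<in> ?C" if "x \<in> ?C" for x k
      proof -
        have "(f ^^ j) ((f ^^ k) x) = (f ^^ (j + k)) x" for j by (simp add: funpow_add)
        then show ?thesis using that by (simp add: pow_closed)
      qed
      have C: "x \<star>\<^bsub>P\<^esub> y \<in> ?C" "qdiv P x y \<in> ?C" if "x \<in> ?C" "y \<in> ?C" for x y
        using that Z(1)
        by (auto simp: subquandle_def P.closed P.qdiv_closed
            quandle_hom_mult[OF pow_hom] quandle_hom_qdiv[OF P P pow_hom])
      have "subquandle (?C <+> carrier Q) ?U"
        unfolding subquandle_def
      proof (intro conjI ballI)
        show "?C <+> carrier Q \<subseteq> carrier ?U" by (auto simp: carrier_quandle_union)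
      next
        fix u v assume uv: "u \<in> ?C <+> carrier Q" "v \<in> ?C <+> carrier Q"
        then have uvU: "u \<in> carrier ?U" "v \<in> carrier ?U" by (auto simp: carrier_quandle_union)
        have "u \<star>\<^bsub>?U\<^esub> v \<in> ?C <+> carrier Q \<and> qdiv ?U u v \<in> ?C <+> carrier Q"
        proof (cases u)
          case (Inl x)
          then have x: "x \<in> ?C" using uv by auto
          show ?thesis
          proof (cases v)
            case v: (Inl y)
            then have y: "y \<in> ?C" using uv by auto
            then have "qdiv ?U u v = Inl (qdiv P x y)"
              using x Inl v qdiv_quandle_union_Inl(1)[OF P qU] by simp
            then show ?thesis using C[OF x y] Inl v by (simp only: quandle_union_mult InlI)
          next
            case v: (Inr y)
            \<comment> \<open>Dividing by an element of \<open>Q\<close> applies the inverse of \<open>f\<close>, which is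
              \<open>f ^^ (n - 1)\<close>, so it stays within the orbit.\<close>
            have "qdiv ?U u v = Inl ((f ^^ (n - 1)) x)"
              using x uv Inl v qdiv_quandle_union_Inl(2)[OF P qU, of x "(f ^^ (n - 1)) x" y]
                root[of x] pow_closed by auto
            moreover have "f x \<in> ?C" using fC[OF x, of 1] by simp
            ultimately show ?thesis
              using fC[OF x, of "n - 1"] Inl v by (simp only: quandle_union_mult InlI)
          qed
        next
          case (Inr x)
          have "qdiv ?U u v \<star>\<^bsub>?U\<^esub> v = u" using uvU by (rule U.qdiv_mult)
          then have "qdiv ?U u v \<in> range Inr"
            using Inr by (cases "qdiv ?U u v"; cases v) (auto simp: quandle_union_mult)
          moreover have "u \<star>\<^bsub>?U\<^esub> v \<in> range Inr"
            using Inr by (cases v) (auto simp: quandle_union_mult)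
          ultimately show ?thesis
            using U.closed[OF uvU] U.qdiv_closed[OF uvU] by (auto simp: carrier_quandle_union)
        qed
        then show "u \<star>\<^bsub>?U\<^esub> v \<in> ?C <+> carrier Q" "qdiv ?U u v \<in> ?C <+> carrier Q" by auto
      qed
      moreover have "A \<subseteq> ?C <+> carrier Q"
      proof
        fix u assume u: "u \<in> A"
        show "u \<in> ?C <+> carrier Q"
        proof (cases u)
          case (Inl a)
          have a: "a \<in> carrier P" using u Inl A(2) YU by auto
          have "(f ^^ k) a \<in> Z" for k
          proof -
            have "(f ^^ k) a = (f ^^ (k mod n)) a" using n(2)[OF a] by (simp add: funpow_mod_eq)
            moreover have "k mod n < n" using n(1) by simp
            ultimately show ?thesis using Z(2) u Inl by fastforce
          qed
          then show ?thesis using Inl a by auto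
        next
          case (Inr a)
          then show ?thesis using u A(2) YU by auto
        qed
      qed
      ultimately have "Y \<subseteq> ?C <+> carrier Q" by (rule min)
      moreover have "?C \<subseteq> Z"
      proof
        fix x assume "x \<in> ?C"
        then have "(f ^^ 0) x \<in> Z" by blast
        then show "x \<in> Z" by simp
      qed
      ultimately show ?thesis by auto
    qed
    ultimately show ?thesis
      by (rule finitely_generated_subquandleI[OF sub])
  qed
qed


text \<open>The separating homomorphism \<open>\<phi>\<close> on \<open>P\<close> is corestricted to its image before it is extended: the
  map induced by \<open>f\<close> is determined only there, and there it inherits from \<open>f\<close> surjectivity, which
  on a finite set gives bijectivity.\<close>

lemma separate_Inl:
  fixes P :: "('a, 'm) quandle_scheme" and Q :: "('b, 'n) quandle_scheme"
  assumes P: "quandle P" and f: "f \<in> carrier (Inn P)" "central_automorphism P f"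
    and sep: "separable_in (Inl -` Y) P"
    and Y: "Y \<subseteq> carrier (quandle_union P f Q g)"
    and x: "x \<in> carrier P" "Inl x \<notin> Y"
  shows "\<exists>(F :: nat quandle) \<phi>. quandle F \<and> finite (carrier F) \<and>
     \<phi> \<in> quandle_hom (quandle_union P f Q g) F \<and> \<phi> (Inl x) \<notin> \<phi> ` Y"
proof -
  interpret P: quandle P by (rule P)
  obtain F :: "nat quandle" and \<phi> where F: "quandle F" "finite (carrier F)"
    and \<phi>: "\<phi> \<in> quandle_hom P F" and \<phi>x: "\<phi> x \<notin> \<phi> ` (Inl -` Y)"
    using sep x unfolding separable_in_def by blast
  interpret F: quandle F by (rule F)
  have fhom: "f \<in> quandle_hom P P" and fbij: "bij_betw f (carrier P) (carrier P)"
    and fcent: "\<And>x y. x \<in> carrier P \<Longrightarrow> y \<in> carrier P \<Longrightarrow> f (x \<star>\<^bsub>P\<^esub> y) = f x \<star>\<^bsub>P\<^esub> y"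
    using f(2) by (auto simp: central_automorphism_def)
  have fc: "f a \<in> carrier P" if "a \<in> carrier P" for a
    using fhom that by (rule quandle_hom_closed)
  define I where "I = F\<lparr>carrier := \<phi> ` carrier P\<rparr>"
  have I: "quandle I"
    unfolding I_def
    using subquandle_image[OF P F(1) \<phi> P.subquandle_carrier] by (rule F.quandle_restrict)
  have carI: "carrier I = \<phi> ` carrier P" and opI: "a \<star>\<^bsub>I\<^esub> b = a \<star>\<^bsub>F\<^esub> b" for a b
    by (simp_all add: I_def)
  have "\<phi> ` carrier P \<subseteq> carrier F" using quandle_hom_closed[OF \<phi>] by auto
  then have finI: "finite (carrier I)" using F(2) carI finite_subset by metis
  define f' where "f' a = \<phi> (f (inv_into (carrier P) \<phi> a))" for a
  have f': "f' (\<phi> a) = \<phi> (f a)" if a: "a \<in> carrier P" for a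
    unfolding f'_def
    by (rule P.inner_automorphism_respects_hom[OF F(1) \<phi> f(1)])
      (use a in \<open>auto intro: inv_into_into simp: f_inv_into_f\<close>)
  have "f' ` carrier I = \<phi> ` f ` carrier P" by (force simp: carI f' image_image)
  then have surj: "f' ` carrier I = carrier I"
    using fbij by (simp add: carI bij_betw_imp_surj_on)
  then have "bij_betw f' (carrier I) (carrier I)"
    using finI by (simp add: bij_betw_def finite_surj_inj)
  moreover have "f' \<in> quandle_hom I I"
    using quandle_hom_mult[OF \<phi>] quandle_hom_mult[OF fhom] P.closed fc
    by (auto simp: quandle_hom_def carI opI f' simp flip: quandle_hom_mult[OF \<phi>])
  moreover have "f' (a \<star>\<^bsub>I\<^esub> b) = f' a \<star>\<^bsub>I\<^esub> b" if "a \<in> carrier I" "b \<in> carrier I" for a b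
    using that fcent P.closed fc
    by (auto simp: carI opI f' simp flip: quandle_hom_mult[OF \<phi>])
  ultimately have f'_central: "central_automorphism I f'"
    by (simp add: central_automorphism_def)
  \<comment> \<open>All of \<open>Q\<close> is sent to the point of \<open>T\<close>, on which \<open>g\<close> induces the identity, while right multiplication
    by that point is \<open>f'\<close> on the image of \<open>\<phi>\<close>.\<close>
  define T :: "unit quandle" where "T = \<lparr>carrier = UNIV, qop = \<lambda>_ _. ()\<rparr>"
  have T: "quandle T" by unfold_locales (auto simp: T_def)
  have idT: "central_automorphism T id"
    by (auto simp: central_automorphism_def quandle_hom_def T_def)
  let ?G = "quandle_union I f' T id"
  have "quandle ?G" using I T f'_central idT by (rule quandle_quandle_union)
  moreover have "finite (carrier ?G)" using finI by (simp add: carrier_quandle_union T_def)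
  moreover have "map_sum \<phi> (\<lambda>_. ()) \<in> quandle_hom (quandle_union P f Q g) ?G"
    by (auto simp: quandle_hom_def carrier_quandle_union quandle_union_mult carI opI f' T_def
        quandle_hom_mult[OF \<phi>])
  moreover have "map_sum \<phi> (\<lambda>_. ()) (Inl x) \<notin> map_sum \<phi> (\<lambda>_. ()) ` Y"
  proof
    assume "map_sum \<phi> (\<lambda>_. ()) (Inl x) \<in> map_sum \<phi> (\<lambda>_. ()) ` Y"
    then obtain u where "u \<in> Y" "Inl (\<phi> x) = map_sum \<phi> (\<lambda>_. ()) u" by auto
    then show False using \<phi>x by (cases u) auto
  qed
  ultimately show ?thesis
    using x Y by (intro separated_by_any_finite_quandle) (auto simp: carrier_quandle_union)
qed

theorem proposition5p6:
  fixes X\<^sub>1 :: "'a quandle" and X\<^sub>2 :: "'b quandle"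
    and f :: "'a \<Rightarrow> 'a" and g :: "'b \<Rightarrow> 'b"
  assumes "subquandle_separable X\<^sub>1" and "subquandle_separable X\<^sub>2"
    and "f \<in> group_center (Inn X\<^sub>1)" and "finite_order (Inn X\<^sub>1) f"
    and "g \<in> group_center (Inn X\<^sub>2)" and "finite_order (Inn X\<^sub>2) g"
  shows "subquandle_separable (quandle_union X\<^sub>1 f X\<^sub>2 g)"
proof -
  let ?U = "quandle_union X\<^sub>1 f X\<^sub>2 g" and ?V = "quandle_union X\<^sub>2 g X\<^sub>1 f"
  let ?s = "case_sum Inr Inl :: 'a + 'b \<Rightarrow> 'b + 'a"
  have X1: "quandle X\<^sub>1" and X2: "quandle X\<^sub>2"
    using assms by (simp_all add: subquandle_separable_def)
  have f: "f \<in> carrier (Inn X\<^sub>1)" and g: "g \<in> carrier (Inn X\<^sub>2)"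
    using assms by (simp_all add: group_center_def)
  have fc: "central_automorphism X\<^sub>1 f" and gc: "central_automorphism X\<^sub>2 g"
    using assms X1 X2 by (simp_all add: quandle.central_automorphism_if_center)
  obtain n where n: "n > 0" "\<And>x. x \<in> carrier X\<^sub>1 \<Longrightarrow> (f ^^ n) x = x"
    using quandle.finite_order_funpow[OF X1 f assms(4)] by blast
  obtain m where m: "m > 0" "\<And>x. x \<in> carrier X\<^sub>2 \<Longrightarrow> (g ^^ m) x = x"
    using quandle.finite_order_funpow[OF X2 g assms(6)] by blast
  have U: "quandle ?U" using X1 X2 fc gc by (rule quandle_quandle_union)
  have V: "quandle ?V" using X2 X1 gc fc by (rule quandle_quandle_union)
  have "separable_in Y ?U" if Y: "finitely_generated_subquandle Y ?U" for Y
    unfolding separable_in_def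
  proof (intro conjI ballI)
    show YU: "Y \<subseteq> carrier ?U"
      using Y by (simp add: finitely_generated_subquandle_def subquandle_def)
    fix u assume u: "u \<in> carrier ?U - Y"
    show "\<exists>(F :: nat quandle) \<phi>. quandle F \<and> finite (carrier F) \<and>
        \<phi> \<in> quandle_hom ?U F \<and> \<phi> u \<notin> \<phi> ` Y"
    proof (cases u)
      case (Inl x)
      have "separable_in (Inl -` Y) X\<^sub>1"
        using finitely_generated_Inl_part[OF X1 X2 fc gc n Y] assms(1)
        by (simp add: subquandle_separable_def)
      from separate_Inl[OF X1 f fc this YU] show ?thesis
        using u Inl by (auto simp: carrier_quandle_union)
    next
      case (Inr x)
      have sY: "finitely_generated_subquandle (?s ` Y) ?V"
        using U V swap_hom Y by (rule finitely_generated_subquandle_image)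
      have sep: "separable_in (Inl -` ?s ` Y) X\<^sub>2"
        using finitely_generated_Inl_part[OF X2 X1 gc fc m sY] assms(2)
        by (simp add: subquandle_separable_def)
      have sub: "?s ` Y \<subseteq> carrier ?V"
        using sY by (simp add: finitely_generated_subquandle_def subquandle_def)
      have x: "x \<in> carrier X\<^sub>2" using u Inr by (auto simp: carrier_quandle_union)
      have "Inl x \<notin> ?s ` Y" using u Inr by (auto split: sum.splits)
      from separate_Inl[OF X2 g gc sep sub x this]
      obtain F :: "nat quandle" and \<phi> where F: "quandle F" "finite (carrier F)"
        and \<phi>: "\<phi> \<in> quandle_hom ?V F" "\<phi> (Inl x) \<notin> \<phi> ` ?s ` Y"
        by (elim exE conjE)
      have "\<phi> \<circ> ?s \<in> quandle_hom ?U F"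
        using swap_hom \<phi>(1) by (rule quandle_hom_comp)
      moreover have "(\<phi> \<circ> ?s) u \<notin> (\<phi> \<circ> ?s) ` Y"
        using \<phi>(2) by (simp only: image_comp Inr comp_apply sum.case not_False_eq_True)
      ultimately show ?thesis using F by (intro exI conjI)
    qed
  qed
  with U show ?thesis by (simp add: subquandle_separable_def)
qed

end
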